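(* Let $X$ be a metric space and let $\mathcal{U} = ( U_\alpha )_{\alpha \in \kappa}$ be a locally finite open cover of $X$. Then there exists a locally Lipschitz partition of unity $( \lambda_\alpha )_{\alpha \in \kappa}$ subordinate to $\mathcal{U}$. In addition, suppose that $\mathcal{U}$ has Lebesgue number $\delta > 0$ and that each point of $X$ is contained in at most $N \in \mathbb{N}$ members of $\mathcal{U}$. Then, given any fixed $\delta_0 \in (0,\delta)$, the partition of unity $( \lambda_\alpha )_{\alpha \in \kappa}$ can be chosen such that for all $\alpha\in\kappa$ we have $\mathcal{B}(z,\delta-\delta_0) \subseteq U_{\alpha}$ for all $z \in \operatorname{supp}(\lambda_\alpha)$, and $$\mathsf{L}\left( \lambda_\alpha \right) \leq N \delta_{0}^{-1}, \qquad \mathsf{L}\left( \lambda_\alpha, U_{\alpha} \right) \leq (N-1) \delta_{0}^{-1},$$ and moreover, for any subset $\mu \subseteq \kappa$, $$\mathsf{L}\left( \sum\nolimits_{\beta\in\mu}\lambda_\beta \right) \leq N \delta_{0}^{-1}.$$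
   Context: All metrics are denoted $\Delta$, and $\mathcal{B}(z,r)$ is the open ball of radius $r$ centered at $z$. A number $\delta>0$ is a Lebesgue number of an open cover of $X$ if for all $x\in X$ the ball $\mathcal{B}(x,\delta)$ is contained in some member of the cover. For a map $f$ into a metric space and a subset $U$ of its domain, $\mathsf{L}(f,U)$ denotes the Lipschitz constant of $f$ over $U$, so that $\mathsf L(f,U)\le L$ means $\Delta(f(x),f(x'))\le L\,\Delta(x,x')$ for all $x,x'\in U$; $\mathsf{L}(f)$ denotes the Lipschitz constant over the whole domain. A map is locally Lipschitz if every point has an open neighborhood over which it is Lipschitz. A family of sets is locally finite if every point has an open neighborhood intersecting only finitely many members. A partition of unity $(\lambda_\alpha)_{\alpha\in\kappa}$, $\lambda_\alpha:X\to[0,1]$, is subordinate to $(U_\alpha)_{\alpha\in\kappa}$ if the closed support $\operatorname{supp}(\lambda_\alpha)$ lies in $U_\alpha$ for each $\alpha$; it is locally Lipschitz if each $\lambda_\alpha$ is. *)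

theory Defs
  imports "HOL-Analysis.Analysis"
begin

(* Families are indexed by a set K, and members are counted by index: equal sets
   with different indices are different members. *)

definition locally_finite_family :: "'i set \<Rightarrow> ('i \<Rightarrow> 'a::topological_space set) \<Rightarrow> bool"
  where "locally_finite_family K A \<longleftrightarrow>
    (\<forall>x. \<exists>V. open V \<and> x \<in> V \<and> finite {\<alpha> \<in> K. A \<alpha> \<inter> V \<noteq> {}})"

definition open_cover :: "'i set \<Rightarrow> ('i \<Rightarrow> 'a::topological_space set) \<Rightarrow> bool"
  where "open_cover K U \<longleftrightarrow> (\<forall>\<alpha>\<in>K. open (U \<alpha>)) \<and> (\<Union>\<alpha>\<in>K. U \<alpha>) = UNIV"

definition lebesgue_number :: "'i set \<Rightarrow> ('i \<Rightarrow> 'a::metric_space set) \<Rightarrow> real \<Rightarrow> bool"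
  where "lebesgue_number K U \<delta> \<longleftrightarrow> \<delta> > 0 \<and> (\<forall>x. \<exists>\<alpha>\<in>K. ball x \<delta> \<subseteq> U \<alpha>)"

definition multiplicity_le :: "'i set \<Rightarrow> ('i \<Rightarrow> 'a set) \<Rightarrow> nat \<Rightarrow> bool"
  where "multiplicity_le K U N \<longleftrightarrow>
    (\<forall>x. finite {\<alpha> \<in> K. x \<in> U \<alpha>} \<and> card {\<alpha> \<in> K. x \<in> U \<alpha>} \<le> N)"

definition locally_lipschitz :: "('a::metric_space \<Rightarrow> 'b::metric_space) \<Rightarrow> bool"
  where "locally_lipschitz f \<longleftrightarrow> (\<forall>x. \<exists>V L. open V \<and> x \<in> V \<and> L-lipschitz_on V f)"

definition closed_support :: "('a::topological_space \<Rightarrow> real) \<Rightarrow> 'a set"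
  where "closed_support f = closure (support_on UNIV f)"

(* Local finiteness is required, as in the library's subordinate_partition_of_unity; for a
   partition subordinate to a locally finite cover it is automatic. It makes the pointwise
   sum finite, so that supp_sum is the genuine sum over K and over every subset of K. *)
definition partition_of_unity ::
  "'i set \<Rightarrow> ('i \<Rightarrow> 'a::topological_space \<Rightarrow> real) \<Rightarrow> bool"
  where "partition_of_unity K l \<longleftrightarrow>
    (\<forall>\<alpha>\<in>K. continuous_on UNIV (l \<alpha>) \<and> (\<forall>x. l \<alpha> x \<in> {0..1})) \<and>
    locally_finite_family K (\<lambda>\<alpha>. support_on UNIV (l \<alpha>)) \<and>
    (\<forall>x. supp_sum (\<lambda>\<alpha>. l \<alpha> x) K = 1)"

definition subordinate_to ::
  "'i set \<Rightarrow> ('i \<Rightarrow> 'a::topological_space \<Rightarrow> real) \<Rightarrow> ('i \<Rightarrow> 'a set) \<Rightarrow> bool"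
  where "subordinate_to K l U \<longleftrightarrow> (\<forall>\<alpha>\<in>K. closed_support (l \<alpha>) \<subseteq> U \<alpha>)"

definition locally_lipschitz_partition_subordinate ::
  "'i set \<Rightarrow> ('i \<Rightarrow> 'a::metric_space \<Rightarrow> real) \<Rightarrow> ('i \<Rightarrow> 'a set) \<Rightarrow> bool"
  where "locally_lipschitz_partition_subordinate K l U \<longleftrightarrow>
    partition_of_unity K l \<and> (\<forall>\<alpha>\<in>K. locally_lipschitz (l \<alpha>)) \<and> subordinate_to K l U"

end

theory Submission
  imports Defs
begin

text \<open>
  Both partitions come from the same construction: choose nonnegative, uniformly Lipschitz
  weights \<open>h \<alpha>\<close> whose closed supports lie in \<open>U \<alpha>\<close> and which do not
  all vanish at any point, and divide each by the total weight.

  Let \<open>f \<alpha>\<close> be the distance to the complement of \<open>U \<alpha>\<close>, truncated from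
  above. It is positive exactly on \<open>U \<alpha>\<close>, so its closed support is in general too
  large. Subtracting a positive continuous function \<open>t\<close> and cutting off at \<open>0\<close>
  repairs this, since the closed support is then contained in the set where
  \<open>t \<le> f \<alpha>\<close>. It remains to choose \<open>t\<close> smaller, at every point, than some
  \<open>f \<alpha>\<close>. For an arbitrary cover, half the supremum of the \<open>f \<alpha>\<close> works, and it
  is Lipschitz because a pointwise supremum of 1-Lipschitz functions is 1-Lipschitz. Given a
  Lebesgue number \<open>\<delta>\<close>, every point has some \<open>f \<alpha>\<close> (truncated at
  \<open>\<delta>\<close>) equal to \<open>\<delta>\<close>, so the constant \<open>\<delta> - \<delta>\<^sub>0\<close> works. It keeps
  balls of this radius around the support inside \<open>U \<alpha>\<close>, it keeps the weights
  1-Lipschitz, and it makes the total weight at least \<open>\<delta>\<^sub>0\<close>.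

  The sharp constants come from \<open>quotient_diff_le\<close>. Write a partial sum of the
  partition as \<open>a / (a + b)\<close>, where \<open>a\<close> and \<open>b\<close> are the weights of an index set
  and of its complement, and let primes denote values at a second point. The identity
  \<open>a b' - a' b = (a - a') b + a (b' - b)\<close> uses only the decrease of \<open>a\<close> and the
  increase of \<open>b\<close>, hence one-sided bounds. Only indices with nonzero weight at the
  point with the larger value contribute to a one-sided bound (\<open>weight_diff_le\<close>), so
  the multiplicity at a single point controls it. Counting at both points would instead
  give \<open>2 * N\<close>. If both points lie in \<open>U \<alpha>\<close> and \<open>a\<close> is the single weight
  \<open>h \<alpha>\<close>, then at most \<open>N - 1\<close> indices contribute to \<open>b\<close>, which gives the
  better constant on \<open>U \<alpha>\<close>.
\<close>

section \<open>Finite-support sums\<close>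

lemma supp_sum_eq_sum:
  fixes f :: "'i \<Rightarrow> real"
  assumes "finite F" "F \<subseteq> I" "\<And>i. i \<in> I \<Longrightarrow> f i \<noteq> 0 \<Longrightarrow> i \<in> F"
  shows "supp_sum f I = sum f F"
  unfolding supp_sum_def
proof (rule sum.mono_neutral_left)
  show "support_on I f \<subseteq> F"
    using assms(3) by (auto simp: support_on_def)
  show "\<forall>i\<in>F - support_on I f. f i = 0"
    using assms(2) by (auto simp: support_on_def)
qed (rule assms(1))

lemma supp_sum_split:
  fixes f :: "'i \<Rightarrow> real"
  assumes "finite (support_on I f)" "J \<subseteq> I"
  shows "supp_sum f I = supp_sum f J + supp_sum f (I - J)"
proof -
  have "support_on I f = support_on J f \<union> support_on (I - J) f"
    "support_on J f \<inter> support_on (I - J) f = {}"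
    using assms(2) by (auto simp: support_on_def)
  then show ?thesis
    unfolding supp_sum_def using assms(1) by (metis finite_Un sum.union_disjoint)
qed

section \<open>Locally Lipschitz functions\<close>

lemma locally_lipschitz_imp_continuous:
  fixes f :: "'a::metric_space \<Rightarrow> 'b::metric_space"
  assumes "locally_lipschitz f"
  shows "continuous_on UNIV f"
proof -
  have "isCont f x" for x
  proof -
    obtain V L where "open V" "x \<in> V" "L-lipschitz_on V f"
      using assms unfolding locally_lipschitz_def by blast
    then show ?thesis
      by (metis lipschitz_on_continuous_on continuous_on_eq_continuous_at)
  qed
  then show ?thesis
    by (simp add: continuous_on_eq_continuous_at)
qed

lemma lipschitz_onI_one_sided:
  fixes f :: "'a::metric_space \<Rightarrow> real"
  assumes "\<And>x y. x \<in> V \<Longrightarrow> y \<in> V \<Longrightarrow> f x - f y \<le> L * dist x y" "0 \<le> L"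
  shows "L-lipschitz_on V f"
proof (rule lipschitz_onI)
  fix x y assume "x \<in> V" "y \<in> V"
  then show "dist (f x) (f y) \<le> L * dist x y"
    using assms(1)[of x y] assms(1)[of y x] by (simp add: dist_real_def dist_commute abs_le_iff)
qed (rule assms(2))

lemma lipschitz_on_diffD:
  fixes f :: "'a::metric_space \<Rightarrow> real"
  assumes "L-lipschitz_on V f" "x \<in> V" "y \<in> V"
  shows "f x - f y \<le> L * dist x y"
  using lipschitz_onD[OF assms] by (simp add: dist_real_def)

lemma lipschitz_on_max_zero:
  fixes f :: "'a::metric_space \<Rightarrow> real"
  assumes "L-lipschitz_on V f"
  shows "L-lipschitz_on V (\<lambda>x. max 0 (f x))"
proof (rule lipschitz_onI_one_sided)
  show "0 \<le> L" using assms by (rule lipschitz_on_nonneg)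
  fix x y assume "x \<in> V" "y \<in> V"
  then have "f x - f y \<le> L * dist x y" by (rule lipschitz_on_diffD[OF assms])
  moreover have "0 \<le> L * dist x y" using \<open>0 \<le> L\<close> by simp
  ultimately show "max 0 (f x) - max 0 (f y) \<le> L * dist x y" by linarith
qed

text \<open>
  The support itself lies in the set where \<open>t < f\<close>; weakening the inequality makes the set
  closed, and hence it contains the closure of the support.
\<close>

lemma closed_support_max_zero_subset:
  fixes f t :: "'a::metric_space \<Rightarrow> real"
  assumes "continuous_on UNIV f" "continuous_on UNIV t"
  shows "closed_support (\<lambda>x. max 0 (f x - t x)) \<subseteq> {x. t x \<le> f x}"
  unfolding closed_support_def
proof (rule closure_minimal)
  show "closed {x. t x \<le> f x}"
    using assms by (rule closed_Collect_le[rotated])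
qed (auto simp: support_on_def max_def split: if_splits)

section \<open>Truncated distance to the complement\<close>

text \<open>
  The library sets the distance to the empty set to \<open>0\<close>. Here it must count as infinite,
  so the whole space gets the truncation value \<open>c\<close> at every point.
\<close>

definition depth :: "real \<Rightarrow> 'a::metric_space set \<Rightarrow> 'a \<Rightarrow> real"
  where "depth c A x = (if A = UNIV then c else min c (infdist x (- A)))"

lemma depth_le: "depth c A x \<le> c"
  by (simp add: depth_def)

lemma depth_outside: "0 \<le> c \<Longrightarrow> x \<notin> A \<Longrightarrow> depth c A x = 0"
  by (auto simp: depth_def)

lemma depth_pos:
  assumes "0 < c" "open A" "x \<in> A"
  shows "0 < depth c A x"
proof (cases "A = UNIV")
  case False
  then have "infdist x (- A) \<noteq> 0"
    using assms in_closed_iff_infdist_zero[of "- A" x] by auto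
  then show ?thesis
    using assms(1) infdist_nonneg[of x "- A"] by (simp add: depth_def)
qed (use assms in \<open>simp add: depth_def\<close>)

lemma ball_subset_of_le_depth:
  assumes "r \<le> depth c A x"
  shows "ball x r \<subseteq> A"
proof (cases "A = UNIV")
  case False
  show ?thesis
  proof
    fix y assume "y \<in> ball x r"
    then have "dist x y < infdist x (- A)"
      using assms False by (simp add: depth_def)
    then show "y \<in> A"
      using infdist_le[of y "- A" x] by fastforce
  qed
qed simp

lemma depth_eq_of_ball_subset:
  assumes "ball x c \<subseteq> A"
  shows "depth c A x = c"
proof (cases "A = UNIV")
  case False
  then have "c \<le> (INF a\<in>- A. dist x a)"
    using assms by (intro cINF_greatest) (auto simp: subset_iff not_less[symmetric])
  then have "c \<le> infdist x (- A)"
    using False by (subst infdist_notempty) auto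
  then show ?thesis by (simp add: depth_def)
qed (simp add: depth_def)

lemma lipschitz_depth: "1-lipschitz_on UNIV (depth c A)"
proof (rule lipschitz_onI_one_sided)
  fix x y
  have "infdist x (- A) \<le> infdist y (- A) + dist x y"
    by (rule infdist_triangle)
  moreover have "0 \<le> dist x y" by simp
  ultimately show "depth c A x - depth c A y \<le> 1 * dist x y"
    unfolding depth_def by (smt (verit))
qed simp

section \<open>Normalising a family of weights\<close>

text \<open>
  In the numerator \<open>(a - a') * b + a * (b' - b)\<close> the two one-sided variations have the
  coefficients \<open>b\<close> and \<open>a\<close>, which add up to one of the two denominators. After
  cancelling it, a common bound \<open>k\<close> of both variations enters once and not twice.
\<close>

lemma quotient_diff_le:
  fixes a b a' b' c k :: real
  assumes "0 \<le> a" "0 \<le> b" "0 < a + b" "0 < c" "c \<le> a' + b'" "0 \<le> k"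
    and "a - a' \<le> k" "b' - b \<le> k"
  shows "a / (a + b) - a' / (a' + b') \<le> k / c"
proof -
  have S': "0 < a' + b'" using assms by linarith
  have "a * b' - a' * b = (a - a') * b + a * (b' - b)" by algebra
  also have "\<dots> \<le> k * b + a * k"
    using assms by (intro add_mono mult_right_mono mult_left_mono)
  finally have num: "a * b' - a' * b \<le> k * (a + b)" by (simp add: algebra_simps)
  have "a / (a + b) - a' / (a' + b') = (a * b' - a' * b) / ((a + b) * (a' + b'))"
    using assms(3) S' by (simp add: diff_frac_eq algebra_simps)
  also have "\<dots> \<le> k * (a + b) / ((a + b) * (a' + b'))"
    using num assms(3) S' by (intro divide_right_mono) auto
  also have "\<dots> = k / (a' + b')" using assms(3) by simp
  also have "\<dots> \<le> k / c" using assms by (intro divide_left_mono mult_pos_pos S') auto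
  finally show ?thesis .
qed

text \<open>
  The data from which a partition of unity is obtained by normalisation. A common Lipschitz
  constant lets an estimate for a sum of weights depend only on the number of its terms.
\<close>

locale lipschitz_weights =
  fixes K :: "'i set" and U :: "'i \<Rightarrow> 'a::metric_space set" and h :: "'i \<Rightarrow> 'a \<Rightarrow> real"
    and L :: real
  assumes locally_finite: "locally_finite_family K U"
    and nonneg: "\<And>\<alpha> x. 0 \<le> h \<alpha> x"
    and lipschitz: "\<And>\<alpha>. \<alpha> \<in> K \<Longrightarrow> L-lipschitz_on UNIV (h \<alpha>)"
    and closed_support_subset: "\<And>\<alpha>. \<alpha> \<in> K \<Longrightarrow> closed_support (h \<alpha>) \<subseteq> U \<alpha>"
    and exists_pos: "\<And>x. \<exists>\<alpha>\<in>K. 0 < h \<alpha> x"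
begin

definition weight :: "'i set \<Rightarrow> 'a \<Rightarrow> real"
  where "weight J x = supp_sum (\<lambda>\<beta>. h \<beta> x) J"

definition normalised :: "'i \<Rightarrow> 'a \<Rightarrow> real"
  where "normalised \<alpha> x = h \<alpha> x / weight K x"

lemma L_nonneg: "0 \<le> L"
  using exists_pos lipschitz by (meson lipschitz_on_nonneg)

lemma in_U: "\<alpha> \<in> K \<Longrightarrow> h \<alpha> x \<noteq> 0 \<Longrightarrow> x \<in> U \<alpha>"
  using closed_support_subset[of \<alpha>] closure_subset[of "support_on UNIV (h \<alpha>)"]
  by (auto simp: closed_support_def support_on_def)

lemma local_index_set:
  "\<exists>V F. open V \<and> x \<in> V \<and> finite F \<and> (\<forall>\<alpha>\<in>K. \<forall>y\<in>V. h \<alpha> y \<noteq> 0 \<longrightarrow> \<alpha> \<in> F)"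
proof -
  obtain V where "open V" "x \<in> V" "finite {\<alpha> \<in> K. U \<alpha> \<inter> V \<noteq> {}}"
    using locally_finite unfolding locally_finite_family_def by blast
  then show ?thesis
    using in_U by (intro exI[of _ V] exI[of _ "{\<alpha> \<in> K. U \<alpha> \<inter> V \<noteq> {}}"]) auto
qed

lemma finite_support: "J \<subseteq> K \<Longrightarrow> finite (support_on J (\<lambda>\<beta>. h \<beta> x))"
proof -
  assume "J \<subseteq> K"
  obtain V F where "open V" "x \<in> V" "finite F"
    "\<forall>\<alpha>\<in>K. \<forall>y\<in>V. h \<alpha> y \<noteq> 0 \<longrightarrow> \<alpha> \<in> F"
    using local_index_set[of x] by blast
  with \<open>J \<subseteq> K\<close> show ?thesis
    by (auto simp: support_on_def intro: rev_finite_subset)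
qed

lemma weight_nonneg: "0 \<le> weight J x"
  unfolding weight_def supp_sum_def by (rule sum_nonneg) (rule nonneg)

lemma weight_split: "J \<subseteq> K \<Longrightarrow> weight K x = weight J x + weight (K - J) x"
  unfolding weight_def by (rule supp_sum_split[OF finite_support]) auto

lemma weight_singleton: "weight {\<alpha>} x = h \<alpha> x"
  unfolding weight_def by (subst supp_sum_eq_sum[of "{\<alpha>}"]) auto

lemma le_weight: "\<alpha> \<in> K \<Longrightarrow> h \<alpha> x \<le> weight K x"
  using weight_split[of "{\<alpha>}" x] weight_nonneg[of "K - {\<alpha>}" x]
  by (simp add: weight_singleton)

lemma weight_pos: "0 < weight K x"
  using exists_pos[of x] le_weight[of _ x] by force

lemma supp_sum_normalised: "supp_sum (\<lambda>\<beta>. normalised \<beta> x) J = weight J x / weight K x"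
proof -
  have "support_on J (\<lambda>\<beta>. normalised \<beta> x) = support_on J (\<lambda>\<beta>. h \<beta> x)"
    using weight_pos[of x] by (auto simp: support_on_def normalised_def)
  then show ?thesis
    by (simp add: supp_sum_def weight_def normalised_def sum_divide_distrib)
qed

lemma support_normalised: "support_on UNIV (normalised \<alpha>) = support_on UNIV (h \<alpha>)"
  using weight_pos by (auto simp: support_on_def normalised_def) (metis less_irrefl)

lemma closed_support_normalised: "closed_support (normalised \<alpha>) = closed_support (h \<alpha>)"
  by (simp add: closed_support_def support_normalised)

text \<open>
  An index whose weight vanishes at \<open>x\<close> contributes a nonpositive term to the
  difference, so only the indices active at \<open>x\<close> are counted.
\<close>

lemma weight_diff_le:
  assumes "J \<subseteq> K"
  shows "weight J x - weight J y \<le> real (card {\<beta> \<in> J. h \<beta> x \<noteq> 0}) * (L * dist x y)"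
proof -
  define P where "P = {\<beta> \<in> J. h \<beta> x \<noteq> 0}"
  define Q where "Q = {\<beta> \<in> J. h \<beta> y \<noteq> 0}"
  have fin: "finite P" "finite Q"
    using finite_support[OF assms, of x] finite_support[OF assms, of y]
    by (simp_all add: P_def Q_def support_on_def)
  have "weight J x = (\<Sum>\<beta>\<in>P. h \<beta> x)"
    unfolding weight_def using fin by (intro supp_sum_eq_sum) (auto simp: P_def)
  moreover have "(\<Sum>\<beta>\<in>P. h \<beta> y) \<le> (\<Sum>\<beta>\<in>P \<union> Q. h \<beta> y)"
    using fin nonneg by (intro sum_mono2) auto
  moreover have "weight J y = (\<Sum>\<beta>\<in>P \<union> Q. h \<beta> y)"
    unfolding weight_def using fin by (intro supp_sum_eq_sum) (auto simp: P_def Q_def)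
  ultimately have "weight J x - weight J y \<le> (\<Sum>\<beta>\<in>P. h \<beta> x - h \<beta> y)"
    by (simp add: sum_subtractf)
  also have "\<dots> \<le> (\<Sum>\<beta>\<in>P. L * dist x y)"
    using assms by (intro sum_mono lipschitz_on_diffD[OF lipschitz]) (auto simp: P_def)
  finally show ?thesis by (simp add: P_def)
qed

lemma weight_diff_le_bound:
  assumes "J \<subseteq> K" "card {\<beta> \<in> J. h \<beta> x \<noteq> 0} \<le> k"
  shows "weight J x - weight J y \<le> real k * (L * dist x y)"
proof -
  have "real (card {\<beta> \<in> J. h \<beta> x \<noteq> 0}) * (L * dist x y) \<le> real k * (L * dist x y)"
    using assms(2) L_nonneg by (intro mult_right_mono) auto
  with weight_diff_le[OF assms(1), of x y] show ?thesis by linarith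
qed

text \<open>
  The bound \<open>k\<close> is on the indices inside \<open>J\<close> and outside \<open>J\<close> separately,
  not on their total. With \<open>J\<close> a singleton, this is what allows \<open>N - 1\<close> in place of
  \<open>N\<close> on a member of the cover. Taking \<open>V\<close> to be a small neighbourhood shows that
  the normalised weights are locally Lipschitz.
\<close>

lemma lipschitz_partial_sum:
  assumes J: "J \<subseteq> K" and c: "0 < c" "\<And>x. x \<in> V \<Longrightarrow> c \<le> weight K x"
    and k: "\<And>x. x \<in> V \<Longrightarrow> card {\<beta> \<in> J. h \<beta> x \<noteq> 0} \<le> k"
      "\<And>x. x \<in> V \<Longrightarrow> card {\<beta> \<in> K - J. h \<beta> x \<noteq> 0} \<le> k"
  shows "(real k * L / c)-lipschitz_on V (\<lambda>x. supp_sum (\<lambda>\<beta>. normalised \<beta> x) J)"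
proof (rule lipschitz_onI_one_sided)
  fix x y assume xy: "x \<in> V" "y \<in> V"
  have "weight J x / (weight J x + weight (K - J) x) - weight J y / (weight J y + weight (K - J) y)
      \<le> (real k * (L * dist x y)) / c"
  proof (rule quotient_diff_le)
    show "weight J x - weight J y \<le> real k * (L * dist x y)"
      by (rule weight_diff_le_bound[OF J k(1)[OF xy(1)]])
    show "weight (K - J) y - weight (K - J) x \<le> real k * (L * dist x y)"
      using weight_diff_le_bound[OF Diff_subset k(2)[OF xy(2)], of x] by (simp add: dist_commute)
    show "0 < weight J x + weight (K - J) x" "c \<le> weight J y + weight (K - J) y"
      using weight_pos[of x] c(2)[OF xy(2)] weight_split[OF J] by simp_all
  qed (use c L_nonneg in \<open>simp_all add: weight_nonneg\<close>)
  then show "supp_sum (\<lambda>\<beta>. normalised \<beta> x) J - supp_sum (\<lambda>\<beta>. normalised \<beta> y) J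
      \<le> real k * L / c * dist x y"
    by (simp add: supp_sum_normalised weight_split[OF J] mult.assoc)
qed (use c L_nonneg in simp)

lemma locally_bounded_count:
  "\<exists>V k. open V \<and> x \<in> V \<and> (\<forall>J\<subseteq>K. \<forall>y\<in>V. card {\<beta> \<in> J. h \<beta> y \<noteq> 0} \<le> k)"
proof -
  obtain V F where VF: "open V" "x \<in> V" "finite F"
    "\<forall>\<beta>\<in>K. \<forall>y\<in>V. h \<beta> y \<noteq> 0 \<longrightarrow> \<beta> \<in> F"
    using local_index_set[of x] by blast
  then have "\<forall>J\<subseteq>K. \<forall>y\<in>V. card {\<beta> \<in> J. h \<beta> y \<noteq> 0} \<le> card F"
    by (auto intro!: card_mono)
  with VF show ?thesis by blast
qed

lemma continuous_weight: "continuous_on UNIV (weight K)"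
proof (rule locally_lipschitz_imp_continuous, unfold locally_lipschitz_def, rule allI)
  fix x
  obtain V k where V: "open V" "x \<in> V"
    "\<forall>J\<subseteq>K. \<forall>y\<in>V. card {\<beta> \<in> J. h \<beta> y \<noteq> 0} \<le> k"
    using locally_bounded_count[of x] by blast
  have "(real k * L)-lipschitz_on V (weight K)"
    using weight_diff_le_bound[OF order_refl] V(3) L_nonneg
    by (intro lipschitz_onI_one_sided) (auto simp: mult.assoc)
  with V show "\<exists>V L. open V \<and> x \<in> V \<and> L-lipschitz_on V (weight K)" by blast
qed

lemma normalised_eq_supp_sum: "normalised \<alpha> = (\<lambda>x. supp_sum (\<lambda>\<beta>. normalised \<beta> x) {\<alpha>})"
  by (simp add: supp_sum_normalised weight_singleton normalised_def fun_eq_iff)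

text \<open>
  Near any point the number of active indices is bounded, and by continuity the total weight
  stays above half of its value there, so the quotient estimate applies with these constants.
\<close>

lemma locally_lipschitz_normalised:
  assumes "\<alpha> \<in> K"
  shows "locally_lipschitz (normalised \<alpha>)"
  unfolding locally_lipschitz_def
proof
  fix x
  obtain V k where V: "open V" "x \<in> V"
    "\<forall>J\<subseteq>K. \<forall>y\<in>V. card {\<beta> \<in> J. h \<beta> y \<noteq> 0} \<le> k"
    using locally_bounded_count[of x] by blast
  define c where "c = weight K x / 2"
  define W where "W = V \<inter> {y. c < weight K y}"
  have c: "0 < c" using weight_pos[of x] by (simp add: c_def)
  have "open W"
    unfolding W_def using V(1) by (intro open_Int open_Collect_less continuous_weight) auto
  moreover have "x \<in> W" using V(2) weight_pos[of x] by (simp add: W_def c_def)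
  moreover have "(real k * L / c)-lipschitz_on W (normalised \<alpha>)"
  proof (subst normalised_eq_supp_sum, rule lipschitz_partial_sum)
    fix y assume y: "y \<in> W"
    show "c \<le> weight K y" using y by (simp add: W_def)
    show "card {\<beta> \<in> {\<alpha>}. h \<beta> y \<noteq> 0} \<le> k" "card {\<beta> \<in> K - {\<alpha>}. h \<beta> y \<noteq> 0} \<le> k"
      using V(3)[rule_format, of "{\<alpha>}" y] V(3)[rule_format, of "K - {\<alpha>}" y] y assms
      unfolding W_def by blast+
  qed (use assms c in auto)
  ultimately show "\<exists>V L. open V \<and> x \<in> V \<and> L-lipschitz_on V (normalised \<alpha>)" by blast
qed

lemma locally_lipschitz_partition_normalised:
  "locally_lipschitz_partition_subordinate K normalised U"
proof -
  have "normalised \<alpha> x \<in> {0..1}" if "\<alpha> \<in> K" for \<alpha> x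
    using le_weight[OF that, of x] nonneg[of \<alpha> x] weight_pos[of x]
    by (simp add: normalised_def)
  moreover have "locally_finite_family K (\<lambda>\<alpha>. support_on UNIV (normalised \<alpha>))"
    unfolding locally_finite_family_def
  proof
    fix x
    obtain V F where VF: "open V" "x \<in> V" "finite F"
      "\<forall>\<alpha>\<in>K. \<forall>y\<in>V. h \<alpha> y \<noteq> 0 \<longrightarrow> \<alpha> \<in> F"
      using local_index_set[of x] by blast
    then have "{\<alpha> \<in> K. support_on UNIV (normalised \<alpha>) \<inter> V \<noteq> {}} \<subseteq> F"
      unfolding support_normalised by (auto simp: support_on_def)
    with VF show "\<exists>V. open V \<and> x \<in> V \<and>
        finite {\<alpha> \<in> K. support_on UNIV (normalised \<alpha>) \<inter> V \<noteq> {}}"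
      by (meson finite_subset)
  qed
  moreover have "supp_sum (\<lambda>\<alpha>. normalised \<alpha> x) K = 1" for x
    using weight_pos[of x] by (simp add: supp_sum_normalised)
  ultimately show ?thesis
    unfolding locally_lipschitz_partition_subordinate_def partition_of_unity_def subordinate_to_def
    using locally_lipschitz_normalised locally_lipschitz_imp_continuous
      closed_support_subset closed_support_normalised by metis
qed

end

section \<open>The two partitions of unity\<close>

text \<open>
  The truncation at \<open>1\<close> makes the supremum of the depths finite. Half of it is
  exceeded by some depth at every point, so the weights do not all vanish; and it is positive, so
  a point where the depth of \<open>U \<alpha>\<close> reaches it belongs to \<open>U \<alpha>\<close>.
\<close>

lemma exists_locally_lipschitz_partition:
  fixes U :: "'i \<Rightarrow> 'a::metric_space set"
  assumes cover: "open_cover K U" and lf: "locally_finite_family K U"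
  shows "\<exists>l. locally_lipschitz_partition_subordinate K l U"
proof -
  define f where "f \<alpha> = depth 1 (U \<alpha>)" for \<alpha>
  define s where "s x = (SUP \<alpha>\<in>K. f \<alpha> x)" for x
  define h where "h \<alpha> x = max 0 (f \<alpha> x - s x / 2)" for \<alpha> x
  have K: "K \<noteq> {}"
    using cover by (auto simp: open_cover_def)
  have bdd: "bdd_above ((\<lambda>\<alpha>. f \<alpha> x) ` K)" for x
    by (rule bdd_aboveI[of _ 1]) (auto simp: f_def depth_le)
  have lip_f: "1-lipschitz_on UNIV (f \<alpha>)" for \<alpha>
    unfolding f_def by (rule lipschitz_depth)
  have lip_s: "1-lipschitz_on UNIV s"
  proof (rule lipschitz_onI_one_sided)
    fix x y
    have "f \<alpha> x \<le> s y + dist x y" if "\<alpha> \<in> K" for \<alpha>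
      using cSUP_upper[OF that bdd, of y] lipschitz_on_diffD[OF lip_f, of x y \<alpha>]
      by (simp add: s_def)
    then have "s x \<le> s y + dist x y"
      unfolding s_def[of x] using K by (intro cSUP_least) auto
    then show "s x - s y \<le> 1 * dist x y" by simp
  qed simp
  have s_pos: "0 < s x" for x
  proof -
    obtain \<alpha> where "\<alpha> \<in> K" "x \<in> U \<alpha>" "open (U \<alpha>)"
      using cover by (fastforce simp: open_cover_def)
    then have "0 < f \<alpha> x" "f \<alpha> x \<le> s x"
      unfolding s_def using cSUP_upper[OF _ bdd] by (auto simp: f_def intro: depth_pos)
    then show ?thesis by linarith
  qed
  have lip_diff: "(3/2)-lipschitz_on UNIV (\<lambda>x. f \<alpha> x - s x / 2)" for \<alpha>
  proof (rule lipschitz_onI_one_sided)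
    fix x y
    show "(f \<alpha> x - s x / 2) - (f \<alpha> y - s y / 2) \<le> 3/2 * dist x y"
      using lipschitz_on_diffD[OF lip_f, of x y \<alpha>] lipschitz_on_diffD[OF lip_s, of y x]
      by (simp add: dist_commute field_simps)
  qed simp
  interpret lipschitz_weights K U h "3/2"
  proof
    fix \<alpha>
    show "(3/2)-lipschitz_on UNIV (h \<alpha>)"
      unfolding h_def by (rule lipschitz_on_max_zero[OF lip_diff])
    have "closed_support (h \<alpha>) \<subseteq> {x. s x / 2 \<le> f \<alpha> x}"
      unfolding h_def
      by (rule closed_support_max_zero_subset)
        (intro continuous_intros lipschitz_on_continuous_on[OF lip_f]
          lipschitz_on_continuous_on[OF lip_s]; simp)+
    moreover have "x \<in> U \<alpha>" if "s x / 2 \<le> f \<alpha> x" for x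
      using that s_pos[of x] depth_outside[of 1 x "U \<alpha>"] by (fastforce simp: f_def)
    ultimately show "closed_support (h \<alpha>) \<subseteq> U \<alpha>" by blast
  next
    fix x
    have "s x / 2 < s x" using s_pos[of x] by simp
    then obtain \<alpha> where "\<alpha> \<in> K" "s x / 2 < f \<alpha> x"
      unfolding s_def[of x] using less_cSUP_iff[OF K bdd] by blast
    then show "\<exists>\<alpha>\<in>K. 0 < h \<alpha> x"
      by (intro bexI[of _ \<alpha>]) (simp_all add: h_def)
  qed (simp_all add: lf h_def)
  show ?thesis using locally_lipschitz_partition_normalised by blast
qed

text \<open>
  The Lebesgue number provides, at every point, a weight of at least
  \<open>\<delta> - (\<delta> - \<delta>\<^sub>0) = \<delta>\<^sub>0\<close>. This lower bound for the total weight is the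
  denominator in all the Lipschitz constants, and the numerators count active indices.
\<close>

lemma exists_quantitative_partition:
  fixes U :: "'i \<Rightarrow> 'a::metric_space set"
  assumes lf: "locally_finite_family K U" and leb: "lebesgue_number K U \<delta>"
    and mult: "multiplicity_le K U N" and \<delta>\<^sub>0: "0 < \<delta>\<^sub>0" "\<delta>\<^sub>0 < \<delta>"
  shows "\<exists>l. locally_lipschitz_partition_subordinate K l U \<and>
    (\<forall>\<alpha>\<in>K.
      (\<forall>z \<in> closed_support (l \<alpha>). ball z (\<delta> - \<delta>\<^sub>0) \<subseteq> U \<alpha>) \<and>
      (real N / \<delta>\<^sub>0)-lipschitz_on UNIV (l \<alpha>) \<and>
      ((real N - 1) / \<delta>\<^sub>0)-lipschitz_on (U \<alpha>) (l \<alpha>)) \<and>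
    (\<forall>\<mu>. \<mu> \<subseteq> K \<longrightarrow> (real N / \<delta>\<^sub>0)-lipschitz_on UNIV (\<lambda>x. supp_sum (\<lambda>\<beta>. l \<beta> x) \<mu>))"
proof -
  define \<rho> where "\<rho> = \<delta> - \<delta>\<^sub>0"
  have \<rho>: "0 < \<rho>" using \<delta>\<^sub>0 by (simp add: \<rho>_def)
  define h where "h \<alpha> x = max 0 (depth \<delta> (U \<alpha>) x - \<rho>)" for \<alpha> x
  have ball_support: "ball z \<rho> \<subseteq> U \<alpha>" if "z \<in> closed_support (h \<alpha>)" for z \<alpha>
  proof -
    have "closed_support (h \<alpha>) \<subseteq> {x. \<rho> \<le> depth \<delta> (U \<alpha>) x}"
      unfolding h_def
      by (rule closed_support_max_zero_subset)
        (auto intro: continuous_intros lipschitz_on_continuous_on[OF lipschitz_depth])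
    with that show ?thesis by (intro ball_subset_of_le_depth) auto
  qed
  have large: "\<exists>\<alpha>\<in>K. \<delta>\<^sub>0 \<le> h \<alpha> x" for x
  proof -
    obtain \<alpha> where "\<alpha> \<in> K" "ball x \<delta> \<subseteq> U \<alpha>"
      using leb unfolding lebesgue_number_def by blast
    then show ?thesis
      using depth_eq_of_ball_subset[of x \<delta> "U \<alpha>"] by (intro bexI[of _ \<alpha>]) (auto simp: h_def \<rho>_def)
  qed
  interpret lipschitz_weights K U h 1
  proof
    fix \<alpha>
    have "1-lipschitz_on UNIV (\<lambda>x. depth \<delta> (U \<alpha>) x - \<rho>)"
      using lipschitz_depth[of \<delta> "U \<alpha>"] by (simp add: lipschitz_on_def dist_real_def)
    then show "1-lipschitz_on UNIV (h \<alpha>)"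
      unfolding h_def by (rule lipschitz_on_max_zero)
    show "closed_support (h \<alpha>) \<subseteq> U \<alpha>"
      using ball_support[of _ \<alpha>] \<rho> centre_in_ball by blast
  next
    fix x
    show "\<exists>\<alpha>\<in>K. 0 < h \<alpha> x" using large[of x] \<delta>\<^sub>0(1) by force
  qed (simp_all add: lf h_def)
  have total: "\<delta>\<^sub>0 \<le> weight K x" for x
    using large[of x] le_weight[of _ x] by force
  have fin: "finite {\<alpha> \<in> K. x \<in> U \<alpha>}" and card: "card {\<alpha> \<in> K. x \<in> U \<alpha>} \<le> N" for x
    using mult by (auto simp: multiplicity_le_def)
  have count: "card {\<beta> \<in> J. h \<beta> x \<noteq> 0} \<le> N" if "J \<subseteq> K" for J x
  proof -
    have "card {\<beta> \<in> J. h \<beta> x \<noteq> 0} \<le> card {\<alpha> \<in> K. x \<in> U \<alpha>}"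
      by (intro card_mono fin) (use that in_U in blast)
    with card[of x] show ?thesis by linarith
  qed
  have lip_sum: "(real N / \<delta>\<^sub>0)-lipschitz_on UNIV (\<lambda>x. supp_sum (\<lambda>\<beta>. normalised \<beta> x) J)"
    if "J \<subseteq> K" for J
    using lipschitz_partial_sum[OF that \<delta>\<^sub>0(1) total count[OF that] count[OF Diff_subset]]
    by simp
  have lip_single: "(real N / \<delta>\<^sub>0)-lipschitz_on UNIV (normalised \<alpha>)" if "\<alpha> \<in> K" for \<alpha>
    by (subst normalised_eq_supp_sum) (rule lip_sum, use that in simp)
  \<comment> \<open>Over \<open>U \<alpha>\<close> the index \<open>\<alpha>\<close> always takes up one of the \<open>N\<close>
    available places, whether or not its weight vanishes there.\<close>
  have lip_on: "((real N - 1) / \<delta>\<^sub>0)-lipschitz_on (U \<alpha>) (normalised \<alpha>)" if \<alpha>: "\<alpha> \<in> K" for \<alpha>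
  proof -
    have others: "card {\<beta> \<in> K - {\<alpha>}. h \<beta> x \<noteq> 0} \<le> N - 1" if x: "x \<in> U \<alpha>" for x
    proof -
      have "card {\<beta> \<in> K - {\<alpha>}. h \<beta> x \<noteq> 0} \<le> card ({\<beta> \<in> K. x \<in> U \<beta>} - {\<alpha>})"
        by (intro card_mono finite_Diff fin) (use in_U in blast)
      also have "\<dots> = card {\<beta> \<in> K. x \<in> U \<beta>} - 1"
        using \<alpha> x by (intro card_Diff_singleton) simp
      finally show ?thesis using card[of x] by linarith
    qed
    have "1 \<le> N"
    proof -
      fix x :: 'a
      obtain \<beta> where "\<beta> \<in> K" "0 < h \<beta> x" using exists_pos by blast
      then have "{\<alpha> \<in> K. x \<in> U \<alpha>} \<noteq> {}" using in_U[of \<beta> x] by auto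
      then show ?thesis using card[of x] fin[of x] card_gt_0_iff by (metis One_nat_def Suc_leI le_trans)
    qed
    \<comment> \<open>The singleton itself may have one active index, so the count \<open>N - 1\<close> covers it
      only for \<open>N \<ge> 2\<close>. For \<open>N = 1\<close> no other weight is active on \<open>U \<alpha>\<close>,
      and the quotient is constantly \<open>1\<close> there.\<close>
    then consider "N = 1" | "1 \<le> N - 1" by linarith
    then show ?thesis
    proof cases
      case 1
      have "normalised \<alpha> x = 1" if x: "x \<in> U \<alpha>" for x
      proof -
        have "finite {\<beta> \<in> K - {\<alpha>}. h \<beta> x \<noteq> 0}"
          using finite_support[of "K - {\<alpha>}" x] by (simp add: support_on_def)
        then have "{\<beta> \<in> K - {\<alpha>}. h \<beta> x \<noteq> 0} = {}"
          using others[OF x] 1 by (metis card_0_eq diff_self_eq_0 le_zero_eq)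
        then have "weight (K - {\<alpha>}) x = 0"
          unfolding weight_def by (subst supp_sum_eq_sum[of "{}"]) auto
        then have "weight K x = h \<alpha> x"
          using weight_split[of "{\<alpha>}" x] \<alpha> by (simp add: weight_singleton)
        then show ?thesis using weight_pos[of x] by (simp add: normalised_def)
      qed
      then show ?thesis using 1 by (simp add: lipschitz_on_def)
    next
      case 2
      have "card {\<beta> \<in> {\<alpha>}. h \<beta> x \<noteq> 0} \<le> 1" for x
        by (rule order_trans[OF card_mono[of "{\<alpha>}"]]) auto
      then have "card {\<beta> \<in> {\<alpha>}. h \<beta> x \<noteq> 0} \<le> N - 1" for x
        using 2 order_trans by blast
      then have "(real (N - 1) / \<delta>\<^sub>0)-lipschitz_on (U \<alpha>) (\<lambda>x. supp_sum (\<lambda>\<beta>. normalised \<beta> x) {\<alpha>})"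
        using lipschitz_partial_sum[of "{\<alpha>}" \<delta>\<^sub>0 "U \<alpha>" "N - 1", OF _ \<delta>\<^sub>0(1) total _ others] \<alpha>
        by simp
      then show ?thesis
        using \<open>1 \<le> N\<close> by (simp add: normalised_eq_supp_sum[symmetric] of_nat_diff)
    qed
  qed
  show ?thesis
    using locally_lipschitz_partition_normalised lip_sum lip_single lip_on
      ball_support[folded closed_support_normalised, unfolded \<rho>_def]
    by (intro exI[of _ normalised]) blast
qed

theorem proposition7p1:
  fixes U :: "'i \<Rightarrow> 'a::metric_space set" and \<kappa> :: "'i set"
  assumes "open_cover \<kappa> U"
    and "locally_finite_family \<kappa> U"
  shows "(\<exists>l :: 'i \<Rightarrow> 'a \<Rightarrow> real. locally_lipschitz_partition_subordinate \<kappa> l U) \<and>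
    (\<forall>(\<delta>::real) (N::nat) (\<delta>\<^sub>0::real).
      lebesgue_number \<kappa> U \<delta> \<and> multiplicity_le \<kappa> U N \<and> \<delta>\<^sub>0 \<in> {0<..<\<delta>} \<longrightarrow>
      (\<exists>l :: 'i \<Rightarrow> 'a \<Rightarrow> real. locally_lipschitz_partition_subordinate \<kappa> l U \<and>
        (\<forall>\<alpha>\<in>\<kappa>.
          (\<forall>z \<in> closed_support (l \<alpha>). ball z (\<delta> - \<delta>\<^sub>0) \<subseteq> U \<alpha>) \<and>
          (real N / \<delta>\<^sub>0)-lipschitz_on UNIV (l \<alpha>) \<and>
          ((real N - 1) / \<delta>\<^sub>0)-lipschitz_on (U \<alpha>) (l \<alpha>)) \<and>
        (\<forall>\<mu>. \<mu> \<subseteq> \<kappa> \<longrightarrow>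
          (real N / \<delta>\<^sub>0)-lipschitz_on UNIV (\<lambda>x. supp_sum (\<lambda>\<beta>. l \<beta> x) \<mu>))))"
proof (intro conjI allI impI)
  show "\<exists>l. locally_lipschitz_partition_subordinate \<kappa> l U"
    using assms by (rule exists_locally_lipschitz_partition)
next
  fix \<delta> \<delta>\<^sub>0 :: real and N :: nat
  assume "lebesgue_number \<kappa> U \<delta> \<and> multiplicity_le \<kappa> U N \<and> \<delta>\<^sub>0 \<in> {0<..<\<delta>}"
  then show "\<exists>l. locally_lipschitz_partition_subordinate \<kappa> l U \<and>
        (\<forall>\<alpha>\<in>\<kappa>.
          (\<forall>z \<in> closed_support (l \<alpha>). ball z (\<delta> - \<delta>\<^sub>0) \<subseteq> U \<alpha>) \<and>
          (real N / \<delta>\<^sub>0)-lipschitz_on UNIV (l \<alpha>) \<and>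
          ((real N - 1) / \<delta>\<^sub>0)-lipschitz_on (U \<alpha>) (l \<alpha>)) \<and>
        (\<forall>\<mu>. \<mu> \<subseteq> \<kappa> \<longrightarrow>
          (real N / \<delta>\<^sub>0)-lipschitz_on UNIV (\<lambda>x. supp_sum (\<lambda>\<beta>. l \<beta> x) \<mu>))"
    using exists_quantitative_partition[OF assms(2), of \<delta> N \<delta>\<^sub>0] by simp
qed

end
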